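(* Let $G$ be a finite simple graph with chromatic number $\chi(G)$. For every $\epsilon>0$ there exists an integer $k_0$ such that for every integer $k\ge k_0$, $ch_k(G)\le k(\chi(G)+\epsilon)$.
   Context: A graph $G=(V,E)$ is $(a:b)$-choosable if for every family of sets $\{S(v):v\in V\}$ with $|S(v)|=a$ for all $v$, there exist subsets $C(v)\subseteq S(v)$ with $|C(v)|=b$ for every $v$ and $C(u)\cap C(v)=\emptyset$ whenever $u,v$ are adjacent. The $k$-th choice number $ch_k(G)$ is the smallest integer $n$ such that $G$ is $(n:k)$-choosable. *)

theory Defs
  imports Complex_Main "Graph_Theory.Pair_Digraph"
begin

(* A finite simple graph is a pair_graph: finite, loop-free, with symmetric arc relation. *)

definition proper_colouring :: "'a pair_pre_digraph \<Rightarrow> nat \<Rightarrow> ('a \<Rightarrow> nat) \<Rightarrow> bool" where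
  "proper_colouring G n c \<longleftrightarrow>
     c ` pverts G \<subseteq> {..<n} \<and> (\<forall>(u, v) \<in> parcs G. c u \<noteq> c v)"

definition chromatic_number :: "'a pair_pre_digraph \<Rightarrow> nat" where
  "chromatic_number G = (LEAST n. \<exists>c. proper_colouring G n c)"

(* Colours are natural numbers; by choosable_any_colours below this is no restriction.
   Finiteness is explicit because card is 0 on infinite sets. *)
definition choosable :: "'a pair_pre_digraph \<Rightarrow> nat \<Rightarrow> nat \<Rightarrow> bool" where
  "choosable G a b \<longleftrightarrow>
     (\<forall>S :: 'a \<Rightarrow> nat set. (\<forall>v \<in> pverts G. finite (S v) \<and> card (S v) = a) \<longrightarrow>
       (\<exists>C. (\<forall>v \<in> pverts G. C v \<subseteq> S v \<and> card (C v) = b) \<and>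
            (\<forall>(u, v) \<in> parcs G. C u \<inter> C v = {})))"

definition choice_number :: "nat \<Rightarrow> 'a pair_pre_digraph \<Rightarrow> nat" where
  "choice_number k G = (LEAST n. choosable G n k)"

lemma (in pair_graph) choosable_any_colours:
  fixes S :: "'a \<Rightarrow> 'c set"
  assumes "choosable G a b"
    and S: "\<And>v. v \<in> pverts G \<Longrightarrow> finite (S v) \<and> card (S v) = a"
  shows "\<exists>C. (\<forall>v \<in> pverts G. C v \<subseteq> S v \<and> card (C v) = b) \<and>
             (\<forall>(u, v) \<in> parcs G. C u \<inter> C v = {})"
proof -
  define U where "U = (\<Union>v \<in> pverts G. S v)"
  have fin: "finite U"
    unfolding U_def using pair_finite_verts S by (intro finite_UN_I) auto
  obtain f :: "'c \<Rightarrow> nat" where f: "inj_on f U"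
    using finite_imp_inj_to_nat_seg[OF fin] by (elim exE conjE)
  have inj: "inj_on f (S v)" if "v \<in> pverts G" for v
    using f that by (rule_tac inj_on_subset[of f U]) (auto simp: U_def)
  have "\<forall>v \<in> pverts G. finite (f ` S v) \<and> card (f ` S v) = a"
    using S inj by (simp add: card_image)
  then obtain D where D': "\<forall>v \<in> pverts G. D v \<subseteq> f ` S v \<and> card (D v) = b"
      "\<forall>(u, v) \<in> parcs G. D u \<inter> D v = {}"
    using assms(1)[unfolded choosable_def, THEN spec, of "\<lambda>v. f ` S v"] by (elim impE exE conjE)
  have D: "D v \<subseteq> f ` S v \<and> card (D v) = b" if "v \<in> pverts G" for v
    using D'(1) that by simp
  have disj: "D u \<inter> D v = {}" if "(u, v) \<in> parcs G" for u v
    using D'(2) that by auto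
  define C where "C v = {x \<in> S v. f x \<in> D v}" for v
  have C: "f ` C v = D v" if "v \<in> pverts G" for v
    using D[OF that] by (auto simp: C_def)
  have "card (C v) = b" if "v \<in> pverts G" for v
  proof -
    have "inj_on f (C v)"
      using inj[OF that] by (rule inj_on_subset) (auto simp: C_def)
    then show ?thesis
      using card_image[of f "C v"] C[OF that] D[OF that] by simp
  qed
  moreover have "C u \<inter> C v = {}" if "(u, v) \<in> parcs G" for u v
    using disj[OF that] by (auto simp: C_def)
  moreover have "C v \<subseteq> S v" for v
    by (auto simp: C_def)
  ultimately show ?thesis
    by (intro exI[of _ C]) (simp add: split_beta)
qed

lemma (in pair_graph) chromatic_number_attained:
  "\<exists>c. proper_colouring G (chromatic_number G) c"
proof -
  obtain f :: "'a \<Rightarrow> nat" and n where f: "f ` pverts G = {i. i < n}" "inj_on f (pverts G)"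
    using finite_imp_inj_to_nat_seg[OF pair_finite_verts] by (elim exE conjE)
  have "f u \<noteq> f v" if "(u, v) \<in> parcs G" for u v
    using inj_on_eq_iff[OF f(2) in_arcsD1[OF that] in_arcsD2[OF that]] pair_no_loops[OF that]
    by simp
  then have "proper_colouring G n f"
    unfolding proper_colouring_def f(1) by (simp add: lessThan_def split_beta)
  then have "\<exists>n c. proper_colouring G n c"
    by (intro exI)
  then show ?thesis
    unfolding chromatic_number_def by (rule LeastI_ex)
qed

lemma (in pair_graph) choice_number_attained:
  "choosable G (choice_number k G) k"
proof -
  have "choosable G (k * card (pverts G)) k"
    unfolding choosable_def
  proof (intro allI impI)
    fix S :: "'a \<Rightarrow> nat set"
    assume S: "\<forall>v \<in> pverts G. finite (S v) \<and> card (S v) = k * card (pverts G)"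
    have "\<exists>C. (\<forall>v \<in> W. C v \<subseteq> S v \<and> finite (C v) \<and> card (C v) = k) \<and>
              (\<forall>u \<in> W. \<forall>v \<in> W. u \<noteq> v \<longrightarrow> C u \<inter> C v = {})"
      if "finite W" "W \<subseteq> pverts G" for W
      using that
    proof (induction W rule: finite_induct)
      case empty
      show ?case by simp
    next
      case (insert x W)
      then have "W \<subseteq> pverts G" by simp
      then obtain C where C: "\<forall>v \<in> W. C v \<subseteq> S v \<and> finite (C v) \<and> card (C v) = k"
        and disj: "\<forall>u \<in> W. \<forall>v \<in> W. u \<noteq> v \<longrightarrow> C u \<inter> C v = {}"
        using insert.IH by (elim meta_impE exE conjE)
      let ?U = "\<Union>v \<in> W. C v"
      have "finite ?U" using insert.hyps C by (intro finite_UN_I) auto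
      have "card ?U \<le> (\<Sum>v\<in>W. card (C v))"
        using insert.hyps(1) by (rule card_UN_le)
      also have "\<dots> = k * card W" using C by simp
      finally have U: "card ?U \<le> k * card W" .
      have "Suc (card W) \<le> card (pverts G)"
        using card_mono[OF pair_finite_verts insert.prems] insert.hyps by simp
      then have "k * Suc (card W) \<le> card (S x)"
        using S insert.prems by (simp del: mult_Suc_right)
      then have "k \<le> card (S x) - card ?U" using U by simp
      also have "\<dots> \<le> card (S x - ?U)"
        using \<open>finite ?U\<close> by (rule diff_card_le_card_Diff)
      finally obtain D where D: "D \<subseteq> S x - ?U" "card D = k" "finite D"
        by (rule obtain_subset_with_card_n)
      show ?case
      proof (intro exI[of _ "C(x := D)"] conjI ballI impI)
        fix v assume "v \<in> insert x W"
        then show "(C(x := D)) v \<subseteq> S v" "finite ((C(x := D)) v)" "card ((C(x := D)) v) = k"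
          using C D by auto
      next
        fix u v assume uv: "u \<in> insert x W" "v \<in> insert x W" "u \<noteq> v"
        have "D \<inter> C w = {}" if "w \<in> W" for w using D(1) that by auto
        then show "(C(x := D)) u \<inter> (C(x := D)) v = {}"
          using uv disj by (cases "u = x"; cases "v = x") (simp_all add: Int_commute)
      qed
    qed
    from this[OF pair_finite_verts subset_refl] obtain C where
      C: "\<forall>v \<in> pverts G. C v \<subseteq> S v \<and> finite (C v) \<and> card (C v) = k"
      and disj: "\<forall>u \<in> pverts G. \<forall>v \<in> pverts G. u \<noteq> v \<longrightarrow> C u \<inter> C v = {}"
      by (elim exE conjE)
    have "C u \<inter> C v = {}" if "(u, v) \<in> parcs G" for u v
      using disj in_arcsD1[OF that] in_arcsD2[OF that] pair_no_loops[OF that] by simp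
    then show "\<exists>C. (\<forall>v \<in> pverts G. C v \<subseteq> S v \<and> card (C v) = k) \<and>
                     (\<forall>(u, v) \<in> parcs G. C u \<inter> C v = {})"
      using C by (intro exI[of _ C]) auto
  qed
  then show ?thesis
    unfolding choice_number_def by (rule LeastI)
qed

end

theory Submission
  imports Defs
begin

text \<open>
  Call two colours equivalent if they lie in the same lists; there are at most \<open>2 ^ card V\<close>
  classes, independently of the length of the lists. Split every class as evenly as possible into
  \<open>\<chi>(G)\<close> parts and let a vertex with colour \<open>i\<close> in an optimal proper colouring use the \<open>i\<close>-th
  parts only. Adjacent vertices then use disjoint sets of colours, and a list of length \<open>n\<close> retains
  at least \<open>n / \<chi>(G) - 2 ^ card V\<close> colours, where the error term does not grow with \<open>k\<close>.
\<close>

text \<open>Number the elements of \<open>A\<close> and label each by its index modulo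
  \<open>r\<close>. The indices \<open>q * r + i\<close> with \<open>q < card A div r\<close> all
  stay below \<open>card A\<close>, so every label \<open>i < r\<close> occurs at least
  \<open>card A div r\<close> times.\<close>

lemma ex_balanced_labelling:
  fixes A :: "'c set"
  assumes "finite A"
  shows "\<exists>g :: 'c \<Rightarrow> nat. \<forall>i<r. card A div r \<le> card {x \<in> A. g x = i}"
proof -
  obtain h where h: "bij_betw h {0..<card A} A"
    using ex_bij_betw_nat_finite[OF assms] by blast
  define g where "g x = inv_into {0..<card A} h x mod r" for x
  have "card A div r \<le> card {x \<in> A. g x = i}" if "i < r" for i
  proof -
    let ?f = "\<lambda>q. h (q * r + i)"
    have lt: "q * r + i < card A" if "q < card A div r" for q
    proof -
      have "q * r + i < Suc q * r" using \<open>i < r\<close> by simp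
      also have "\<dots> \<le> card A div r * r" using that by (intro mult_le_mono1) simp
      also have "\<dots> \<le> card A" by simp
      finally show ?thesis .
    qed
    have "inj_on ?f {..<card A div r}"
    proof (rule inj_onI)
      fix p q assume "p \<in> {..<card A div r}" "q \<in> {..<card A div r}" "?f p = ?f q"
      then have "p * r + i = q * r + i"
        using lt inj_onD[OF bij_betw_imp_inj_on[OF h], of "p * r + i" "q * r + i"] by simp
      then show "p = q" using \<open>i < r\<close> by simp
    qed
    moreover have "?f ` {..<card A div r} \<subseteq> {x \<in> A. g x = i}"
    proof clarify
      fix q assume "q < card A div r"
      then have q: "q * r + i \<in> {0..<card A}" using lt by simp
      have "inv_into {0..<card A} h (?f q) = q * r + i"
        by (rule inv_into_f_f[OF bij_betw_imp_inj_on[OF h] q])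
      then show "?f q \<in> A \<and> g (?f q) = i"
        using bij_betwE[OF h] q \<open>i < r\<close> by (simp add: g_def)
    qed
    ultimately have "card {..<card A div r} \<le> card {x \<in> A. g x = i}"
      using assms by (intro card_inj_on_le[of ?f]) auto
    then show ?thesis by simp
  qed
  then show ?thesis by blast
qed

lemma card_eq_sum_fibres:
  assumes "finite A" "finite T" "f ` A \<subseteq> T"
  shows "card A = (\<Sum>t\<in>T. card {x \<in> A. f x = t})"
  using sum.group[OF assms, of "\<lambda>_. 1::nat"] by simp

text \<open>Each list is a disjoint union of equivalence classes, so balancing every class
  separately balances all lists at once. Rounding costs at most one per class; multiplying by
  \<open>r\<close> avoids division.\<close>

lemma ex_labelling_balanced_on_family:
  fixes S :: "'a \<Rightarrow> 'c set"
  assumes V: "finite V" and S: "\<And>v. v \<in> V \<Longrightarrow> finite (S v)"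
  shows "\<exists>g :: 'c \<Rightarrow> nat. \<forall>v\<in>V. \<forall>i<r.
           card (S v) \<le> r * (card {x \<in> S v. g x = i} + 2 ^ card V)"
proof -
  define U where "U = (\<Union>v\<in>V. S v)"
  \<comment> \<open>The fibres of \<open>lists\<close> over \<open>U\<close> are the equivalence
    classes of colours.\<close>
  define lists where "lists x = {v \<in> V. x \<in> S v}" for x
  have "finite U" unfolding U_def using V S by blast
  then have "\<forall>t. \<exists>g :: 'c \<Rightarrow> nat. \<forall>i<r. card {x \<in> U. lists x = t} div r
               \<le> card {x \<in> {x \<in> U. lists x = t}. g x = i}"
    by (intro allI ex_balanced_labelling) simp
  from choice[OF this] obtain h :: "'a set \<Rightarrow> 'c \<Rightarrow> nat" where
    h: "\<forall>t. \<forall>i<r. card {x \<in> U. lists x = t} div r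
          \<le> card {x \<in> {x \<in> U. lists x = t}. h t x = i}" ..
  define g where "g x = h (lists x) x" for x
  have "card (S v) \<le> r * (card {x \<in> S v. g x = i} + 2 ^ card V)" if "v \<in> V" "i < r" for v i
  proof -
    let ?B = "{x \<in> S v. g x = i}"
    \<comment> \<open>A class indexed by \<open>t\<close> lies entirely inside \<open>S v\<close> if
      \<open>v \<in> t\<close> and misses it otherwise. The \<open>+ 1\<close> absorbs the remainder
      modulo \<open>r\<close>.\<close>
    have fibre: "card {x \<in> S v. lists x = t} \<le> r * (card {x \<in> ?B. lists x = t} + 1)" for t
    proof (cases "v \<in> t")
      case True
      then have A: "{x \<in> S v. lists x = t} = {x \<in> U. lists x = t}"
        using \<open>v \<in> V\<close> by (auto simp: U_def lists_def)
      then have B: "{x \<in> ?B. lists x = t} = {x \<in> {x \<in> U. lists x = t}. h t x = i}"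
        by (auto simp: g_def)
      let ?a = "card {x \<in> U. lists x = t}"
      have "?a = r * (?a div r) + ?a mod r" by simp
      also have "\<dots> \<le> r * (?a div r) + r"
        using \<open>i < r\<close> by (intro add_left_mono less_imp_le mod_less_divisor) simp
      also have "\<dots> = r * (?a div r + 1)" by simp
      also have "\<dots> \<le> r * (card {x \<in> ?B. lists x = t} + 1)"
        unfolding B using h \<open>i < r\<close> by (intro mult_le_mono2) simp
      finally show ?thesis unfolding A .
    next
      case False
      then have "{x \<in> S v. lists x = t} = {}" using \<open>v \<in> V\<close> by (auto simp: lists_def)
      then show ?thesis by (simp only: card.empty le0)
    qed
    \<comment> \<open>Classes are indexed by subsets of \<open>V\<close>, which is where
      \<open>2 ^ card V\<close> comes from.\<close>
    have lists: "lists ` X \<subseteq> Pow V" for X by (auto simp: lists_def)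
    have "card (S v) = (\<Sum>t\<in>Pow V. card {x \<in> S v. lists x = t})"
      using V S \<open>v \<in> V\<close> lists by (intro card_eq_sum_fibres) auto
    also have "\<dots> \<le> (\<Sum>t\<in>Pow V. r * (card {x \<in> ?B. lists x = t} + 1))"
      by (intro sum_mono fibre)
    also have "\<dots> = r * ((\<Sum>t\<in>Pow V. card {x \<in> ?B. lists x = t}) + 2 ^ card V)"
      unfolding sum_distrib_left[symmetric] sum.distrib using V by (simp add: card_Pow)
    also have "(\<Sum>t\<in>Pow V. card {x \<in> ?B. lists x = t}) = card ?B"
      using V S \<open>v \<in> V\<close> lists by (intro card_eq_sum_fibres[symmetric]) auto
    finally show ?thesis .
  qed
  then show ?thesis by blast
qed

text \<open>Vertex \<open>v\<close> keeps only the colours of its list labelled \<open>c v\<close>.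
  Adjacent vertices keep different labels, hence disjoint sets, and the bound on \<open>n\<close>
  leaves at least \<open>k\<close> colours.\<close>

lemma (in pair_graph) choosable_if_proper_colouring:
  assumes c: "proper_colouring G r c" and n: "r * (k + 2 ^ card (pverts G)) \<le> n"
  shows "choosable G n k"
  unfolding choosable_def
proof (intro allI impI)
  fix S :: "'a \<Rightarrow> nat set"
  assume S: "\<forall>v \<in> pverts G. finite (S v) \<and> card (S v) = n"
  then obtain g :: "nat \<Rightarrow> nat" where g: "\<forall>v\<in>pverts G. \<forall>i<r.
      card (S v) \<le> r * (card {x \<in> S v. g x = i} + 2 ^ card (pverts G))"
    using ex_labelling_balanced_on_family[OF pair_finite_verts, of S r] by blast
  have "\<exists>D. D \<subseteq> {x \<in> S v. g x = c v} \<and> card D = k" if v: "v \<in> pverts G" for v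
  proof -
    have "c v < r" using c v by (auto simp: proper_colouring_def)
    then have "n \<le> r * (card {x \<in> S v. g x = c v} + 2 ^ card (pverts G))"
      using g S v by metis
    with n have "r * (k + 2 ^ card (pverts G))
        \<le> r * (card {x \<in> S v. g x = c v} + 2 ^ card (pverts G))"
      by (rule le_trans)
    \<comment> \<open>Cancelling the factor \<open>r\<close> is sound since \<open>c v < r\<close>
      makes it positive.\<close>
    then have "k \<le> card {x \<in> S v. g x = c v}" using \<open>c v < r\<close> by simp
    then show ?thesis by (meson obtain_subset_with_card_n)
  qed
  then obtain C where C: "\<And>v. v \<in> pverts G \<Longrightarrow> C v \<subseteq> {x \<in> S v. g x = c v} \<and> card (C v) = k"
    by metis
  have "C u \<inter> C v = {}" if "(u, v) \<in> parcs G" for u v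
  proof -
    have "c u \<noteq> c v" using c that by (auto simp: proper_colouring_def)
    moreover have "g x = c u" if "x \<in> C u" for x
      using C[OF in_arcsD1[OF \<open>(u, v) \<in> parcs G\<close>]] that by blast
    moreover have "g x = c v" if "x \<in> C v" for x
      using C[OF in_arcsD2[OF \<open>(u, v) \<in> parcs G\<close>]] that by blast
    ultimately show ?thesis by fastforce
  qed
  then show "\<exists>C. (\<forall>v \<in> pverts G. C v \<subseteq> S v \<and> card (C v) = k) \<and>
                  (\<forall>(u, v) \<in> parcs G. C u \<inter> C v = {})"
    using C by (intro exI[of _ C] conjI ballI) (blast, blast, simp add: split_beta)
qed

lemma (in pair_graph) choice_number_le:
  "choice_number k G \<le> chromatic_number G * (k + 2 ^ card (pverts G))"
  using chromatic_number_attained choosable_if_proper_colouring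
  unfolding choice_number_def by (blast intro: Least_le)

theorem theorem1:
  fixes G :: "'a pair_pre_digraph" and \<epsilon> :: real
  assumes "pair_graph G" and "\<epsilon> > 0"
  shows "\<exists>k0 :: nat. \<forall>k \<ge> k0.
           real (choice_number k G) \<le> real k * (real (chromatic_number G) + \<epsilon>)"
proof -
  let ?r = "chromatic_number G" and ?M = "2 ^ card (pverts G) :: nat"
  \<comment> \<open>From \<open>k0\<close> on, the error \<open>?r * ?M\<close>, which is
    independent of \<open>k\<close>, is at most \<open>k * \<epsilon>\<close>.\<close>
  obtain k0 :: nat where k0: "real (?r * ?M) / \<epsilon> \<le> real k0"
    using real_arch_simple by blast
  have "real (choice_number k G) \<le> real k * (real ?r + \<epsilon>)" if "k \<ge> k0" for k
  proof -
    have "real (?r * ?M) / \<epsilon> \<le> real k" using k0 that by linarith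
    then have "real (?r * ?M) \<le> real k * \<epsilon>"
      using \<open>\<epsilon> > 0\<close> by (simp add: pos_divide_le_eq)
    moreover have "real (choice_number k G) \<le> real (?r * (k + ?M))"
      using pair_graph.choice_number_le[OF assms(1)] by (rule of_nat_mono)
    ultimately show ?thesis by (simp add: algebra_simps)
  qed
  then show ?thesis by blast
qed

end
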